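(* There exists a non-prosoluble profinite group $G$ containing an element $g$ such that the solubilizer $\Omega_{\mathfrak S}(g,G)$ coincides with the closed subgroup of $G$ generated by $g$.
   Context: $\mathfrak S$ is the class of finite soluble groups. A profinite group is prosoluble if all its quotients by open normal subgroups are soluble. For a profinite group $G$ and $g\in G$, the solubilizer of $g$ in $G$ is $\Omega_{\mathfrak S}(g,G)=\{y\in G\mid \langle g,y\rangle \text{ is prosoluble}\}$, where $\langle g,y\rangle$ denotes the closed subgroup generated by $g$ and $y$. *)

theory Defs
  imports "HOL-Algebra.Solvable_Groups" "HOL-Analysis.Abstract_Topological_Spaces"
begin

locale topological_group = group G
  for G :: "('a, 'b) monoid_scheme" (structure) and T :: "'a topology" +
  assumes topspace_eq: "topspace T = carrier G"
    and continuous_mult: "continuous_map (prod_topology T T) T (\<lambda>(x, y). x \<otimes> y)"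
    and continuous_inv: "continuous_map T T (\<lambda>x. inv x)"

definition totally_disconnected_space :: "'a topology \<Rightarrow> bool" where
  "totally_disconnected_space T \<longleftrightarrow>
     (\<forall>x \<in> topspace T. connected_component_of_set T x = {x})"

locale profinite_group = topological_group G T
  for G :: "('a, 'b) monoid_scheme" (structure) and T :: "'a topology" +
  assumes compact: "compact_space T"
    and Hausdorff: "Hausdorff_space T"
    and totally_disconnected: "totally_disconnected_space T"

text \<open>
  Open subgroups of a compact group have finite index, so the quotients occurring
  below are finite automatically.
\<close>

locale prosoluble_group = profinite_group G T
  for G :: "('a, 'b) monoid_scheme" (structure) and T :: "'a topology" +
  assumes solvable_quotients: "N \<lhd> G \<Longrightarrow> openin T N \<Longrightarrow> solvable (G Mod N)"

definition closed_subgroup_generated ::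
    "('a, 'b) monoid_scheme \<Rightarrow> 'a topology \<Rightarrow> 'a set \<Rightarrow> 'a set" where
  "closed_subgroup_generated G T S = \<Inter>{H. subgroup H G \<and> closedin T H \<and> S \<subseteq> H}"

definition solubilizer :: "('a, 'b) monoid_scheme \<Rightarrow> 'a topology \<Rightarrow> 'a \<Rightarrow> 'a set" where
  "solubilizer G T g =
     {y \<in> carrier G.
        let H = closed_subgroup_generated G T {g, y}
        in prosoluble_group (G\<lparr>carrier := H\<rparr>) (subtopology T H)}"

text \<open>
  On the carrier type used for existential statements: every profinite group with a
  countable base is, up to isomorphism, a closed subgroup of a countable product of
  finite groups with carriers in \<^typ>\<open>nat\<close>, so it can be realised on the type
  \<^typ>\<open>nat \<Rightarrow> nat\<close>. Topologically finitely generated profinite groups have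
  a countable base.
\<close>

end

theory Submission
  imports Defs "HOL-Combinatorics.Permutations" "HOL-Algebra.Weak_Morphisms"
    "HOL-Algebra.Product_Groups" "HOL-Algebra.Multiplicative_Group"
begin

text \<open>
  The group is the inverse limit of a tower of finite groups \<open>G n\<close> with compatible elements \<open>g n\<close>. The
  tower is built so that at each storey any \<open>y\<close> in \<open>G (Suc n)\<close> whose image in \<open>G n\<close> is not a power of \<open>g n\<close>
  generates together with \<open>g (Suc n)\<close> an insoluble group. If an element \<open>y\<close> of the limit generates a
  prosoluble group together with \<open>g\<close>, then each component of \<open>y\<close> must therefore be a power of the
  component of \<open>g\<close>, and such elements form exactly the closed subgroup generated by \<open>g\<close>. That
  subgroup is commutative, so it is contained in the solubilizer. As the tower starts with a group not
  generated by \<open>g 0\<close>, the limit is not prosoluble, because otherwise the solubilizer would be everything.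

  The storey over a finite group \<open>G\<close> with element \<open>g\<close> is the regular wreath product of the symmetric
  group of degree 5 with \<open>G\<close>, seen as a group of permutations of \<open>G \<times> {0, ..., 4}\<close> covering left translations.
  The lift of \<open>g\<close> is given first return maps that are 5-cycles on the fibres over \<open>\<langle>g\<rangle>\<close> and 3-cycles
  on the fibres over the other cosets \<open>\<langle>g\<rangle>z\<close>. If \<open>y\<close> lies over an element outside \<open>\<langle>g\<rangle>\<close>, then it moves
  every point of \<open>\<langle>g\<rangle>\<close> to another coset, and the group generated by \<open>y\<close> and the lift contains
  elements that fix a fibre and act on it as a 5-cycle and as a 3-cycle, respectively (\<open>insoluble_lift_exists\<close>).

  Such a group is insoluble: a suitable power of the 5-cycle moves the support of a 3-cycle to a set
  that meets it in one point, and the commutator of the two 3-cycles is a 3-cycle again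
  (\<open>is_cyc3_commutator\<close>). Hence every term of the derived series contains an element acting on the fibre
  as a 3-cycle (\<open>not_solvable_if_commutators_persist\<close>).
\<close>

section \<open>A criterion for insolubility\<close>

text \<open>
  A property \<^term>\<open>P\<close> that passes from \<^term>\<open>p\<close> to the commutator of \<^term>\<open>p\<close> with one of its conjugates is
  inherited by every term of the derived series, since each term is normal.
\<close>
lemma (in group) not_solvable_if_commutators_persist:
  assumes t: "t \<in> carrier G" "P t" and one: "\<not> P \<one>"
    and step: "\<And>p. p \<in> carrier G \<Longrightarrow> P p \<Longrightarrow>
      \<exists>h \<in> carrier G. P (p \<otimes> (h \<otimes> p \<otimes> inv h) \<otimes> inv p \<otimes> inv (h \<otimes> p \<otimes> inv h))"
  shows "\<not> solvable G"
proof -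
  have normal: "(derived G ^^ n) (carrier G) \<lhd> G" for n
    by (induction n) (auto intro: derived_is_normal normal_invI subgroup_self)
  have "\<exists>p \<in> (derived G ^^ n) (carrier G). P p" for n
  proof (induction n)
    case 0
    then show ?case using t by auto
  next
    case (Suc n)
    let ?D = "(derived G ^^ n) (carrier G)"
    obtain p where p: "p \<in> ?D" "P p" using Suc by auto
    interpret D: normal ?D G by (rule normal)
    have pG: "p \<in> carrier G" using p D.subset by auto
    obtain h where h: "h \<in> carrier G"
      "P (p \<otimes> (h \<otimes> p \<otimes> inv h) \<otimes> inv p \<otimes> inv (h \<otimes> p \<otimes> inv h))"
      using step[OF pG p(2)] by auto
    have "h \<otimes> p \<otimes> inv h \<in> ?D" using D.inv_op_closed2 h p by auto
    then have "p \<otimes> (h \<otimes> p \<otimes> inv h) \<otimes> inv p \<otimes> inv (h \<otimes> p \<otimes> inv h) \<in> derived_set G ?D"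
      using p by blast
    then have "p \<otimes> (h \<otimes> p \<otimes> inv h) \<otimes> inv p \<otimes> inv (h \<otimes> p \<otimes> inv h) \<in> derived G ?D"
      unfolding derived_def by (rule generate.incl)
    then show ?case using h by auto
  qed
  then show ?thesis
    using one unfolding solvable_iff_trivial_derived_seq by (metis singletonD)
qed

section \<open>Cycles of length 3 and 5 on five points\<close>

text \<open>
  The inverse of a function; inside group theory, \<open>inv\<close> denotes the inverse of a group element.
\<close>
abbreviation finv :: "('a \<Rightarrow> 'b) \<Rightarrow> 'b \<Rightarrow> 'a" where
  "finv f \<equiv> Hilbert_Choice.inv f"

text \<open>
  The cycle \<open>x \<mapsto> y \<mapsto> z \<mapsto> x\<close>; this is a 3-cycle only when the three points are distinct.
\<close>
definition cyc3 :: "nat \<Rightarrow> nat \<Rightarrow> nat \<Rightarrow> nat \<Rightarrow> nat" where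
  "cyc3 x y z = (\<lambda>i. if i = x then y else if i = y then z else if i = z then x else i)"

text \<open>
  Being a 3-cycle of the five points \<open>{..<5}\<close>.
\<close>
definition is_cyc3 :: "(nat \<Rightarrow> nat) \<Rightarrow> bool" where
  "is_cyc3 \<sigma> \<longleftrightarrow> (\<exists>x y z. x < 5 \<and> y < 5 \<and> z < 5 \<and> distinct [x, y, z] \<and> \<sigma> = cyc3 x y z)"

text \<open>
  The 5-cycle \<open>i \<mapsto> i + 1\<close> of the integers modulo 5, extended by the identity to all natural numbers.
\<close>
definition cyc5 :: "nat \<Rightarrow> nat" where
  "cyc5 = (\<lambda>i. if i < 5 then (i + 1) mod 5 else i)"

lemma cyc3_rotate: "distinct [x, y, z] \<Longrightarrow> cyc3 x y z = cyc3 y z x"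
  by (auto simp: cyc3_def)

lemma conj_cyc3:
  assumes "bij \<tau>"
  shows "\<tau> \<circ> cyc3 x y z \<circ> finv \<tau> = cyc3 (\<tau> x) (\<tau> y) (\<tau> z)"
proof -
  have "\<tau> \<circ> cyc3 x y z = cyc3 (\<tau> x) (\<tau> y) (\<tau> z) \<circ> \<tau>"
    using assms by (intro ext) (simp add: cyc3_def bij_is_inj inj_eq)
  moreover have "\<tau> \<circ> finv \<tau> = id"
    using assms by (simp add: bij_is_surj surj_iff[symmetric])
  ultimately show ?thesis by (simp add: comp_assoc)
qed

lemma cyc3_comp_reverse:
  assumes "distinct [x, y, z]"
  shows "cyc3 x y z \<circ> cyc3 z y x = id"
  using assms by (intro ext) (simp add: cyc3_def)

lemma bij_cyc3: "distinct [x, y, z] \<Longrightarrow> bij (cyc3 x y z)"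
  by (rule o_bij[of "cyc3 z y x"]) (auto intro!: cyc3_comp_reverse)

lemma inv_cyc3: "distinct [x, y, z] \<Longrightarrow> finv (cyc3 x y z) = cyc3 z y x"
  by (rule inv_unique_comp) (auto intro!: cyc3_comp_reverse)

text \<open>
  The commutator of two 3-cycles whose supports share exactly one point is again a 3-cycle.
\<close>
lemma commutator_cyc3:
  assumes "distinct [a, b, c, d, e]"
  shows "cyc3 a b c \<circ> cyc3 a d e \<circ> finv (cyc3 a b c) \<circ> finv (cyc3 a d e) = cyc3 a b d"
proof -
  let ?u = "cyc3 a d e"
  have "?u \<circ> cyc3 c b a \<circ> finv ?u = cyc3 (?u c) (?u b) (?u a)"
    using assms by (intro conj_cyc3 bij_cyc3) simp
  also have "\<dots> = cyc3 c b d" using assms by (auto simp: cyc3_def)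
  finally have "cyc3 a b c \<circ> ?u \<circ> finv (cyc3 a b c) \<circ> finv ?u = cyc3 a b c \<circ> cyc3 c b d"
    using assms by (simp add: inv_cyc3 o_assoc[symmetric])
  also have "\<dots> = cyc3 a b d"
    using assms by (intro ext) (auto simp: cyc3_def)
  finally show ?thesis .
qed

lemma cyc3_permutes:
  assumes "x < 5" "y < 5" "z < 5" "distinct [x, y, z]"
  shows "cyc3 x y z permutes {..<5}"
  unfolding permutes_def
proof
  show "\<forall>i. i \<notin> {..<5} \<longrightarrow> cyc3 x y z i = i"
    using assms by (simp add: cyc3_def)
  show "\<forall>j. \<exists>!i. cyc3 x y z i = j"
    using bij_cyc3[OF assms(4)] by (simp add: bij_iff)
qed

lemma cyc5_permutes: "cyc5 permutes {..<5}"
proof (rule bij_imp_permutes)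
  have "inj_on cyc5 {..<5}"
    by (auto simp: inj_on_def cyc5_def mod_Suc split: if_splits)
  moreover have "cyc5 ` {..<5} \<subseteq> {..<5}" by (auto simp: cyc5_def)
  ultimately show "bij_betw cyc5 {..<5} {..<5}"
    unfolding bij_betw_def using endo_inj_surj[of "{..<5::nat}" cyc5] by blast
qed (simp add: cyc5_def)

lemma cyc5_pow: "i < 5 \<Longrightarrow> (cyc5 ^^ k) i = (i + k) mod 5"
proof (induction k)
  case (Suc k)
  then show ?case by (simp add: cyc5_def mod_Suc_eq)
qed simp

text \<open>
  Every 3-element subset of the integers modulo 5 meets one of its translates in exactly one point:
  if its complement is \<open>{p, q}\<close>, the translate by \<open>2 * (p - q)\<close> does, and up to sign this shift is 1 or 2.
  The triples \<open>u\<close> and \<open>v\<close> below are rotations of \<open>(x, y, z)\<close> and of its translate that begin with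
  the common point.
\<close>
lemma three_subset_translate:
  fixes x y z :: nat
  assumes "x < 5" "y < 5" "z < 5" "distinct [x, y, z]"
  shows "\<exists>k \<in> {1, 2}.
      \<exists>u \<in> {(x, y, z), (y, z, x), (z, x, y)}.
      \<exists>v \<in> (let s = (\<lambda>i. (i + k) mod 5) in {(s x, s y, s z), (s y, s z, s x), (s z, s x, s y)}).
        fst v = fst u \<and> distinct [fst u, fst (snd u), snd (snd u), fst (snd v), snd (snd v)]"
proof -
  have "x \<in> {0,1,2,3,4}" "y \<in> {0,1,2,3,4}" "z \<in> {0,1,2,3,4}" using assms by auto
  then show ?thesis using assms(4)
    unfolding Let_def
    \<comment> \<open>This is a check of all 125 triples.\<close>
    by (elim insertE emptyE) (simp_all)
qed

text \<open>
  The translates of the support of a 3-cycle are the supports of its conjugates by powers of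
  \<^const>\<open>cyc5\<close>; the power is chosen so that the two supports share exactly one point.
\<close>
lemma is_cyc3_commutator:
  assumes "is_cyc3 \<sigma>"
  obtains k where
    "is_cyc3 (\<sigma> \<circ> ((cyc5 ^^ k) \<circ> \<sigma> \<circ> finv (cyc5 ^^ k)) \<circ> finv \<sigma> \<circ> finv ((cyc5 ^^ k) \<circ> \<sigma> \<circ> finv (cyc5 ^^ k)))"
proof -
  obtain x y z where xyz: "x < 5" "y < 5" "z < 5" "distinct [x, y, z]" and \<sigma>: "\<sigma> = cyc3 x y z"
    using assms unfolding is_cyc3_def by blast
  obtain k u v where
    u: "u \<in> {(x, y, z), (y, z, x), (z, x, y)}"
    and v: "v \<in> (let s = (\<lambda>i. (i + k) mod 5) in {(s x, s y, s z), (s y, s z, s x), (s z, s x, s y)})"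
    and uv: "fst v = fst u" "distinct [fst u, fst (snd u), snd (snd u), fst (snd v), snd (snd v)]"
    using three_subset_translate[OF xyz] by (elim bexE conjE) (rule that)
  obtain a b c d e where ueq: "u = (a, b, c)" and veq: "v = (a, d, e)"
    using uv(1) by (metis prod.collapse)
  have dist: "distinct [a, b, c, d, e]"
    using uv(2) unfolding ueq veq by simp
  let ?r = "cyc5 ^^ k"
  have s: "(x + k) mod 5 = ?r x" "(y + k) mod 5 = ?r y" "(z + k) mod 5 = ?r z"
    using xyz by (simp_all add: cyc5_pow)
  have bij: "bij ?r"
    by (intro bij_fn permutes_bij[OF cyc5_permutes])
  have rot: "cyc3 p q r = cyc3 a' b' c'"
    if "distinct [p, q, r]" "(a', b', c') \<in> {(p, q, r), (q, r, p), (r, p, q)}" for p q r a' b' c'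
    using that cyc3_rotate[of p q r] cyc3_rotate[of q r p] by auto
  have 1: "cyc3 x y z = cyc3 a b c"
    using rot[OF xyz(4)] u unfolding ueq by blast
  have "distinct [?r x, ?r y, ?r z]"
    using xyz(4) bij by (auto simp: bij_def inj_eq)
  moreover have "(a, d, e) \<in> {(?r x, ?r y, ?r z), (?r y, ?r z, ?r x), (?r z, ?r x, ?r y)}"
    using v unfolding veq Let_def s .
  ultimately have "cyc3 (?r x) (?r y) (?r z) = cyc3 a d e"
    by (rule rot)
  then have 2: "?r \<circ> \<sigma> \<circ> finv ?r = cyc3 a d e"
    unfolding \<sigma> conj_cyc3[OF bij] .
  have "a < 5" "b < 5" "d < 5"
    using u v xyz unfolding ueq veq Let_def by auto
  then have "is_cyc3 (cyc3 a b d)"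
    unfolding is_cyc3_def using dist by (intro exI[of _ a] exI[of _ b] exI[of _ d]) simp
  then show thesis
    using that[of k] unfolding 2 unfolding \<sigma> 1 commutator_cyc3[OF dist] by blast
qed

lemma is_cyc3_conj:
  assumes "is_cyc3 \<sigma>" "\<tau> permutes {..<5}"
  shows "is_cyc3 (finv \<tau> \<circ> \<sigma> \<circ> \<tau>)"
proof -
  obtain x y z where xyz: "x < 5" "y < 5" "z < 5" "distinct [x, y, z]" and \<sigma>: "\<sigma> = cyc3 x y z"
    using assms unfolding is_cyc3_def by blast
  let ?r = "finv \<tau>"
  have r: "?r permutes {..<5}" using assms(2) by (rule permutes_inv)
  have "?r \<circ> cyc3 x y z \<circ> finv ?r = cyc3 (?r x) (?r y) (?r z)"
    using conj_cyc3 permutes_bij[OF r] by blast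
  moreover have "finv ?r = \<tau>" using assms(2) by (simp add: permutes_inv_inv)
  moreover have "?r x < 5" "?r y < 5" "?r z < 5"
    using permutes_in_image[OF r] xyz by auto
  moreover have "distinct [?r x, ?r y, ?r z]"
    using xyz(4) permutes_inj[OF r] by (auto simp: inj_eq)
  ultimately show ?thesis
    unfolding is_cyc3_def \<sigma> by (intro exI[of _ "?r x"] exI[of _ "?r y"] exI[of _ "?r z"]) simp
qed

lemma not_is_cyc3_id: "\<not> is_cyc3 id"
proof
  assume "is_cyc3 id"
  then obtain x y z where "distinct [x, y, z]" "id = cyc3 x y z"
    unfolding is_cyc3_def by blast
  then have "x = cyc3 x y z x" "x \<noteq> y" by (metis id_apply, simp)
  then show False by (simp add: cyc3_def)
qed

section \<open>The wreath product over a finite group\<close>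

text \<open>
  The permutations of \<open>carrier G \<times> {..<5}\<close> that induce on the base \<^term>\<open>carrier G\<close> a left translation
  of \<open>G\<close>: the regular wreath product of the symmetric group of degree 5 with \<open>G\<close>, written as a
  permutation group. The five points over a base point are its fibre.
\<close>
definition fibred_perms :: "('a, 'b) monoid_scheme \<Rightarrow> ('a \<times> nat \<Rightarrow> 'a \<times> nat) monoid" where
  "fibred_perms G =
    \<lparr>carrier = {p. p permutes (carrier G \<times> {..<5}) \<and>
       (\<exists>x \<in> carrier G. \<forall>z \<in> carrier G. \<forall>i<5. fst (p (z, i)) = x \<otimes>\<^bsub>G\<^esub> z)},
     monoid.mult = (\<circ>), one = id\<rparr>"

text \<open>
  The element of \<open>G\<close> by which a permutation translates the base; it is read off at the base point \<open>\<one>\<close>.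
\<close>
definition base_shift :: "('a, 'b) monoid_scheme \<Rightarrow> ('a \<times> nat \<Rightarrow> 'a \<times> nat) \<Rightarrow> 'a" where
  "base_shift G p = fst (p (\<one>\<^bsub>G\<^esub>, 0))"

text \<open>
  \<^term>\<open>p\<close> maps the fibre over \<^term>\<open>z\<close> onto the fibre over \<^term>\<open>w\<close>, acting on the five labels by \<^term>\<open>\<sigma>\<close>.
\<close>
definition fibre_map :: "('a \<times> nat \<Rightarrow> 'a \<times> nat) \<Rightarrow> 'a \<Rightarrow> 'a \<Rightarrow> (nat \<Rightarrow> nat) \<Rightarrow> bool" where
  "fibre_map p z w \<sigma> \<longleftrightarrow> \<sigma> permutes {..<5} \<and> (\<forall>i<5. p (z, i) = (w, \<sigma> i))"

lemma fibre_map_comp: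
  assumes "fibre_map p z w \<sigma>" "fibre_map q w v \<tau>"
  shows "fibre_map (q \<circ> p) z v (\<tau> \<circ> \<sigma>)"
  using assms permutes_in_image[of \<sigma> "{..<5}"] unfolding fibre_map_def
  by (auto intro: permutes_compose)

lemma fibre_map_id: "fibre_map id z z id"
  by (simp add: fibre_map_def permutes_id)

lemma fibre_map_inv:
  assumes "bij p" "fibre_map p z w \<sigma>"
  shows "fibre_map (finv p) w z (finv \<sigma>)"
  unfolding fibre_map_def
proof (intro conjI allI impI)
  have \<sigma>: "\<sigma> permutes {..<5}" using assms(2) by (simp add: fibre_map_def)
  then show "finv \<sigma> permutes {..<5}" by (rule permutes_inv)
  fix i :: nat assume "i < 5"
  then have "finv \<sigma> i < 5"
    using permutes_in_image[OF permutes_inv[OF \<sigma>]] by blast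
  then have "p (z, finv \<sigma> i) = (w, i)"
    using assms(2) permutes_inverses(1)[OF \<sigma>] by (simp add: fibre_map_def)
  then show "finv p (w, i) = (z, finv \<sigma> i)"
    using assms(1) by (metis bij_inv_eq_iff)
qed

lemma fibre_map_unique:
  assumes "fibre_map p z w \<sigma>" "fibre_map p z w' \<tau>"
  shows "\<sigma> = \<tau>"
proof
  fix i
  show "\<sigma> i = \<tau> i"
    using assms permutes_not_in[of \<sigma> "{..<5}" i] permutes_not_in[of \<tau> "{..<5}" i]
    by (cases "i < 5") (auto simp: fibre_map_def)
qed

context group
begin

lemma fibred_perms_carrierD:
  assumes "p \<in> carrier (fibred_perms G)"
  shows "p permutes (carrier G \<times> {..<5})" "base_shift G p \<in> carrier G"
    "\<And>z i. z \<in> carrier G \<Longrightarrow> i < 5 \<Longrightarrow> fst (p (z, i)) = base_shift G p \<otimes> z"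
proof -
  obtain x where x: "x \<in> carrier G" "\<And>z i. z \<in> carrier G \<Longrightarrow> i < 5 \<Longrightarrow> fst (p (z, i)) = x \<otimes> z"
    using assms unfolding fibred_perms_def by auto
  have "base_shift G p = x"
    unfolding base_shift_def using x by simp
  then show "base_shift G p \<in> carrier G"
    "\<And>z i. z \<in> carrier G \<Longrightarrow> i < 5 \<Longrightarrow> fst (p (z, i)) = base_shift G p \<otimes> z"
    using x by auto
  show "p permutes (carrier G \<times> {..<5})"
    using assms by (simp add: fibred_perms_def)
qed

lemma fibred_perms_carrierI:
  assumes "p permutes (carrier G \<times> {..<5})" "x \<in> carrier G"
    "\<And>z i. z \<in> carrier G \<Longrightarrow> i < 5 \<Longrightarrow> fst (p (z, i)) = x \<otimes> z"
  shows "p \<in> carrier (fibred_perms G)" "base_shift G p = x"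
  using assms unfolding fibred_perms_def base_shift_def by auto

lemma fibred_perms_snd_less:
  assumes "p permutes (carrier G \<times> {..<5})" "z \<in> carrier G" "i < (5::nat)"
  shows "fst (p (z, i)) \<in> carrier G" "snd (p (z, i)) < 5"
  using permutes_in_image[OF assms(1), of "(z, i)"] assms(2,3)
  by (auto simp: mem_Times_iff)

lemma fibred_perms_comp:
  assumes "p \<in> carrier (fibred_perms G)" "q \<in> carrier (fibred_perms G)"
  shows "p \<circ> q \<in> carrier (fibred_perms G)"
    "base_shift G (p \<circ> q) = base_shift G p \<otimes> base_shift G q"
proof -
  note p = fibred_perms_carrierD[OF assms(1)] and q = fibred_perms_carrierD[OF assms(2)]
  have "fst ((p \<circ> q) (z, i)) = base_shift G p \<otimes> base_shift G q \<otimes> z"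
    if "z \<in> carrier G" "i < 5" for z i
  proof -
    obtain w k where wk: "q (z, i) = (w, k)" by fastforce
    have "fst (p (w, k)) = base_shift G p \<otimes> w"
      using fibred_perms_snd_less[OF q(1) that] by (intro p(3)) (auto simp: wk)
    moreover have "w = base_shift G q \<otimes> z"
      using q(3)[OF that] by (simp add: wk)
    ultimately show ?thesis using that p(2) q(2) by (simp add: wk m_assoc)
  qed
  then show "p \<circ> q \<in> carrier (fibred_perms G)"
    "base_shift G (p \<circ> q) = base_shift G p \<otimes> base_shift G q"
    using fibred_perms_carrierI[of "p \<circ> q" "base_shift G p \<otimes> base_shift G q"] p q
    by (auto intro: permutes_compose)
qed

lemma fibred_perms_inv:
  assumes "p \<in> carrier (fibred_perms G)"
  shows "finv p \<in> carrier (fibred_perms G)"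
proof (rule fibred_perms_carrierI(1))
  note p = fibred_perms_carrierD[OF assms]
  show perm: "finv p permutes (carrier G \<times> {..<5})"
    using p(1) by (rule permutes_inv)
  show "inv (base_shift G p) \<in> carrier G" using p(2) by simp
  fix z i assume zi: "z \<in> carrier G" "i < (5::nat)"
  define a where "a = finv p (z, i)"
  have a: "fst a \<in> carrier G" "snd a < 5"
    using fibred_perms_snd_less[OF perm zi] unfolding a_def .
  have "p (fst a, snd a) = (z, i)"
    using permutes_inverses(1)[OF p(1)] by (simp add: a_def)
  then have "z = base_shift G p \<otimes> fst a"
    using p(3)[OF a] by simp
  then have "inv (base_shift G p) \<otimes> z = fst a"
    using a p(2) by (simp add: m_assoc[symmetric])
  then show "fst (finv p (z, i)) = inv (base_shift G p) \<otimes> z"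
    by (simp add: a_def)
qed

lemma fibred_perms_group: "group (fibred_perms G)"
proof (rule groupI)
  show "\<one>\<^bsub>fibred_perms G\<^esub> \<in> carrier (fibred_perms G)"
    using fibred_perms_carrierI(1)[of id \<one>] by (simp add: fibred_perms_def permutes_id)
next
  fix p assume p: "p \<in> carrier (fibred_perms G)"
  then have "finv p \<circ> p = id"
    using fibred_perms_carrierD(1) permutes_inv_o(2) by blast
  then show "\<exists>q \<in> carrier (fibred_perms G). q \<otimes>\<^bsub>fibred_perms G\<^esub> p = \<one>\<^bsub>fibred_perms G\<^esub>"
    using fibred_perms_inv[OF p] by (auto simp: fibred_perms_def)
next
  fix p q assume "p \<in> carrier (fibred_perms G)" "q \<in> carrier (fibred_perms G)"
  then show "p \<otimes>\<^bsub>fibred_perms G\<^esub> q \<in> carrier (fibred_perms G)"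
    using fibred_perms_comp(1) by (simp add: fibred_perms_def)
qed (simp_all add: fibred_perms_def comp_assoc)

lemma fibred_perms_mult: "p \<otimes>\<^bsub>fibred_perms G\<^esub> q = p \<circ> q"
  and fibred_perms_one: "\<one>\<^bsub>fibred_perms G\<^esub> = id"
  by (simp_all add: fibred_perms_def)

lemma fibred_perms_m_inv:
  assumes "p \<in> carrier (fibred_perms G)"
  shows "inv\<^bsub>fibred_perms G\<^esub> p = finv p"
proof -
  interpret W: group "fibred_perms G" by (rule fibred_perms_group)
  have "finv p \<circ> p = id"
    using assms fibred_perms_carrierD(1) permutes_inv_o(2) by blast
  then show ?thesis
    using assms fibred_perms_inv
    by (intro W.inv_equality) (auto simp: fibred_perms_mult fibred_perms_one)
qed

lemma fibred_perms_pow: "p [^]\<^bsub>fibred_perms G\<^esub> (n::nat) = p ^^ n"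
proof -
  interpret W: group "fibred_perms G" by (rule fibred_perms_group)
  show ?thesis
    by (induction n) (simp_all add: fibred_perms_mult fibred_perms_one funpow_Suc_right del: funpow.simps(2))
qed

lemma finite_fibred_perms:
  assumes "finite (carrier G)"
  shows "finite (carrier (fibred_perms G))"
  by (rule finite_subset[of _ "{p. p permutes (carrier G \<times> {..<5})}"])
     (auto simp: fibred_perms_def assms finite_permutations)

lemma base_shift_hom: "base_shift G \<in> hom (fibred_perms G) G"
  using fibred_perms_carrierD(2) fibred_perms_comp(2)
  by (auto simp: hom_def fibred_perms_mult)

lemma fibre_map_exists:
  assumes p: "p \<in> carrier (fibred_perms G)" and z: "z \<in> carrier G"
  obtains \<sigma> where "fibre_map p z (base_shift G p \<otimes> z) \<sigma>"
proof -
  note pD = fibred_perms_carrierD[OF p]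
  define \<sigma> where "\<sigma> i = (if i < 5 then snd (p (z, i)) else i)" for i
  have eq: "p (z, i) = (base_shift G p \<otimes> z, \<sigma> i)" if "i < 5" for i
    using pD(3)[OF z that] that by (simp add: \<sigma>_def prod_eq_iff)
  have "inj_on \<sigma> {..<5}"
  proof
    fix i j assume ij: "i \<in> {..<5}" "j \<in> {..<5}" "\<sigma> i = \<sigma> j"
    then have "p (z, i) = p (z, j)" by (simp add: eq)
    then show "i = j" using permutes_inj[OF pD(1)] by (simp add: inj_eq)
  qed
  moreover have "\<sigma> ` {..<5} \<subseteq> {..<5}"
    using fibred_perms_snd_less(2)[OF pD(1) z] by (auto simp: \<sigma>_def)
  ultimately have "bij_betw \<sigma> {..<5} {..<5}"
    unfolding bij_betw_def using endo_inj_surj[of "{..<5::nat}" \<sigma>] by blast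
  then have "\<sigma> permutes {..<5}"
    by (rule bij_imp_permutes) (simp add: \<sigma>_def)
  then show thesis using that[of \<sigma>] eq by (simp add: fibre_map_def)
qed

text \<open>
  Any family of label permutations, one for each fibre, is realised over any left translation of the base.
\<close>
lemma twisted_translation_exists:
  assumes x: "x \<in> carrier G" and s: "\<And>z. z \<in> carrier G \<Longrightarrow> s z permutes {..<5}"
  obtains p where "p \<in> carrier (fibred_perms G)" "base_shift G p = x"
    "\<And>z. z \<in> carrier G \<Longrightarrow> fibre_map p z (x \<otimes> z) (s z)"
proof -
  let ?X = "carrier G \<times> {..<5::nat}"
  define p where "p a = (if a \<in> ?X then (x \<otimes> fst a, s (fst a) (snd a)) else a)" for a
  define q where "q a = (if a \<in> ?X then (inv x \<otimes> fst a, finv (s (inv x \<otimes> fst a)) (snd a)) else a)" for a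
  have lt: "s z i < 5 \<longleftrightarrow> i < 5" "finv (s z) i < 5 \<longleftrightarrow> i < 5" if "z \<in> carrier G" for z i
    using permutes_in_image[OF s[OF that], of i] permutes_in_image[OF permutes_inv[OF s[OF that]], of i]
    by auto
  have "p \<circ> q = id"
  proof
    fix a show "(p \<circ> q) a = id a"
      using x permutes_inverses(1)[OF s, of "inv x \<otimes> fst a" "snd a"] lt(2)[of "inv x \<otimes> fst a" "snd a"]
      by (cases a) (auto simp: p_def q_def m_assoc[symmetric])
  qed
  moreover have "q \<circ> p = id"
  proof
    fix a show "(q \<circ> p) a = id a"
      using x permutes_inverses(2)[OF s, of "fst a" "snd a"] lt(1)[of "fst a" "snd a"]
      by (cases a) (auto simp: p_def q_def m_assoc[symmetric])
  qed
  ultimately have "bij p" using o_bij by blast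
  then have perm: "p permutes ?X"
    unfolding permutes_def by (auto simp: p_def bij_iff)
  have p: "p (z, i) = (x \<otimes> z, s z i)" if "z \<in> carrier G" "i < 5" for z i
    using that by (simp add: p_def)
  have "p \<in> carrier (fibred_perms G)" "base_shift G p = x"
    using fibred_perms_carrierI[OF perm x] p by simp_all
  then show thesis
    using that[of p] p s by (simp add: fibre_map_def)
qed

lemma base_shift_surj: "base_shift G ` carrier (fibred_perms G) = carrier G"
proof
  show "base_shift G ` carrier (fibred_perms G) \<subseteq> carrier G"
    using fibred_perms_carrierD(2) by auto
  show "carrier G \<subseteq> base_shift G ` carrier (fibred_perms G)"
  proof
    fix x assume "x \<in> carrier G"
    then obtain p where "p \<in> carrier (fibred_perms G)" "base_shift G p = x"
      using twisted_translation_exists[of x "\<lambda>_. id"] permutes_id by metis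
    then show "x \<in> base_shift G ` carrier (fibred_perms G)" by blast
  qed
qed

section \<open>Insoluble lifts\<close>

text \<open>
  The inductive step. The element \<^term>\<open>g\<close> permutes the base in cycles, the right cosets of \<open>\<langle>g\<rangle>\<close>. The
  lift \<^term>\<open>p\<close> is chosen so that its first return to a fibre is a 5-cycle over the points of \<open>\<langle>g\<rangle>\<close> itself
  and a 3-cycle over all other points. An element \<^term>\<open>y\<close> lying over a point outside \<open>\<langle>g\<rangle>\<close> moves every
  point of \<open>\<langle>g\<rangle>\<close> out of \<open>\<langle>g\<rangle>\<close>, and so serves to conjugate a 3-cycle into a fibre to which \<^term>\<open>p\<close>
  returns as a 5-cycle.
\<close>
lemma insoluble_lift_exists:
  assumes fin: "finite (carrier G)" and g: "g \<in> carrier G"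
  obtains p where "p \<in> carrier (fibred_perms G)" "base_shift G p = g"
    "\<And>y K. base_shift G y \<notin> generate G {g} \<Longrightarrow> subgroup K (fibred_perms G) \<Longrightarrow> p \<in> K \<Longrightarrow> y \<in> K
      \<Longrightarrow> \<not> solvable (fibred_perms G\<lparr>carrier := K\<rparr>)"
proof -
  let ?W = "fibred_perms G"
  interpret W: group ?W by (rule fibred_perms_group)
  define C where "C = generate G {g}"
  interpret C: subgroup C G
    unfolding C_def using g by (intro generate_is_subgroup) simp
  have gC: "g [^] (k::nat) \<in> C" for k
    unfolding C_def using generate_pow_on_finite_carrier[OF fin g] by auto
  \<comment> \<open>\<open>\<rho>\<close> chooses one representative in each cycle of \<open>g\<close> on the base.\<close>
  define \<rho> where "\<rho> z = (SOME w. w \<in> C #> z)" for z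
  have \<rho>_mem: "\<rho> z \<in> C #> z" "\<rho> z \<in> carrier G" if "z \<in> carrier G" for z
  proof -
    show "\<rho> z \<in> C #> z"
      unfolding \<rho>_def using rcos_self[OF that C.subgroup_axioms] by (rule someI)
    then show "\<rho> z \<in> carrier G"
      using r_coset_subset_G[OF C.subset that] by auto
  qed
  have \<rho>_eq: "\<rho> w = \<rho> z" if "z \<in> carrier G" "w \<in> C #> z" for w z
    unfolding \<rho>_def using repr_independence[OF that(2,1) C.subgroup_axioms] by simp
  \<comment> \<open>Labels change only when \<open>p\<close> leaves a representative, so a full turn around a cycle picks up
    exactly one nontrivial factor.\<close>
  define s where "s z = (if \<rho> z = z then if z \<in> C then cyc5 else cyc3 0 1 2 else id)" for z
  have "s z permutes {..<5}" for z
    using cyc5_permutes cyc3_permutes[of 0 1 2] by (simp add: s_def permutes_id)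
  then obtain p where p: "p \<in> carrier ?W" "base_shift G p = g"
    and p_fibre: "\<And>z. z \<in> carrier G \<Longrightarrow> fibre_map p z (g \<otimes> z) (s z)"
    using twisted_translation_exists[OF g, of s] by blast
  define m where "m = ord g"
  have m: "m > 0" "g [^] m = \<one>"
    unfolding m_def using ord_ge_1[OF fin g] pow_ord_eq_1[OF g] by auto
  have less_m: "g [^] k \<noteq> \<one>" if "0 < k" "k < m" for k :: nat
    using that pow_eq_id[OF g, of k] unfolding m_def by (auto dest: dvd_imp_le)
  have cycle: "fibre_map (p ^^ k) w (g [^] k \<otimes> w) (if k = 0 then id else s w)"
    if w: "w \<in> carrier G" "\<rho> w = w" and "k \<le> m" for w k
    using \<open>k \<le> m\<close>
  proof (induction k)
    case 0
    then show ?case using w by (simp add: fibre_map_id[unfolded id_def] id_def)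
  next
    case (Suc k)
    have trivial: "s (g [^] k \<otimes> w) = id" if "k \<noteq> 0"
    proof -
      have "\<rho> (g [^] k \<otimes> w) = w"
        using \<rho>_eq[OF w(1)] gC w(2) by (auto simp: r_coset_def)
      moreover have "g [^] k \<otimes> w \<noteq> w"
        using less_m[of k] that Suc.prems g w(1) by (simp add: r_cancel_one)
      ultimately show ?thesis by (simp add: s_def)
    qed
    have "fibre_map p (g [^] k \<otimes> w) (g \<otimes> (g [^] k \<otimes> w)) (s (g [^] k \<otimes> w))"
      using g w by (intro p_fibre) simp
    then have "fibre_map (p \<circ> p ^^ k) w (g \<otimes> (g [^] k \<otimes> w))
        (s (g [^] k \<otimes> w) \<circ> (if k = 0 then id else s w))"
      using Suc.IH Suc.prems by (intro fibre_map_comp) auto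
    moreover have "s (g [^] k \<otimes> w) \<circ> (if k = 0 then id else s w) = s w"
      using trivial w(1) by simp
    ultimately have "fibre_map (p \<circ> p ^^ k) w (g \<otimes> (g [^] k \<otimes> w)) (s w)"
      by simp
    moreover have "g \<otimes> (g [^] k \<otimes> w) = g [^] Suc k \<otimes> w"
      using g w(1) nat_pow_Suc2[OF g] by (simp add: m_assoc)
    ultimately show ?case
      by (simp only: funpow.simps(2) nat.simps if_False)
  qed
  have mono: "fibre_map (p ^^ m) w w (s w)" if "w \<in> carrier G" "\<rho> w = w" for w
    using cycle[OF that, of m] m that by simp

  define w0 where "w0 = \<rho> \<one>"
  have w0: "w0 \<in> C" "\<rho> w0 = w0"
    unfolding w0_def using \<rho>_mem[of \<one>] \<rho>_eq[of \<one> "\<rho> \<one>"] C.subset coset_mult_one by auto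
  then have w0G: "w0 \<in> carrier G" using C.subset by auto
  have c_fibre: "fibre_map (p ^^ m) w0 w0 cyc5"
    using mono[OF w0G w0(2)] w0 by (simp add: s_def)

  show thesis
  proof (rule that[OF p])
    fix y K
    assume y: "base_shift G y \<notin> generate G {g}" and K: "subgroup K ?W" and pK: "p \<in> K" and yK: "y \<in> K"
    interpret K: subgroup K ?W by (rule K)
    let ?H = "?W\<lparr>carrier := K\<rparr>"
    interpret H: group ?H by (rule K.subgroup_is_group[OF W.group_axioms])
    have Kcomp: "q \<circ> r \<in> K" if "q \<in> K" "r \<in> K" for q r
      using K.m_closed[OF that] by (simp add: fibred_perms_mult)
    have Kinv: "finv q \<in> K" if "q \<in> K" for q
      using K.m_inv_closed[OF that] fibred_perms_m_inv K.mem_carrier[OF that] by simp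
    have Kpow: "q ^^ n \<in> K" if "q \<in> K" for q n
      using that by (induction n) (use K.one_closed in \<open>auto simp: fibred_perms_one Kcomp id_def\<close>)
    have Hinv: "inv\<^bsub>?H\<^esub> q = finv q" if "q \<in> K" for q
      using W.m_inv_consistent[OF K that] fibred_perms_m_inv K.mem_carrier[OF that] by simp
    have Kbij: "bij q" if "q \<in> K" for q
      using fibred_perms_carrierD(1)[OF K.mem_carrier[OF that]] by (rule permutes_bij)
    have yW: "y \<in> carrier ?W" using yK K.mem_carrier by blast
    \<comment> \<open>\<open>y\<close> followed by \<open>p ^^ j\<close> carries \<open>w0\<close> to \<open>w1\<close>, the representative of a coset other than \<open>\<langle>g\<rangle>\<close>.\<close>
    define v where "v = base_shift G y \<otimes> w0"
    have bG: "base_shift G y \<in> carrier G" using yW by (rule fibred_perms_carrierD(2))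
    have vG: "v \<in> carrier G" using bG w0G by (simp add: v_def)
    have v: "v \<notin> C"
    proof
      assume "v \<in> C"
      then have "v \<otimes> inv w0 \<in> C" using w0 by simp
      then have "base_shift G y \<in> C" using bG w0G by (simp add: v_def m_assoc)
      then show False using y by (simp add: C_def)
    qed
    obtain j :: nat where j: "\<rho> v = g [^] j \<otimes> v"
      using \<rho>_mem(1)[OF vG] generate_pow_on_finite_carrier[OF fin g] by (auto simp: r_coset_def C_def)
    define w1 where "w1 = \<rho> v"
    have w1: "w1 \<in> carrier G" "\<rho> w1 = w1"
      unfolding w1_def using \<rho>_mem[OF vG] \<rho>_eq[OF vG] by auto
    have "w1 \<notin> C"
    proof
      assume "w1 \<in> C"
      then have "inv (g [^] j) \<otimes> w1 \<in> C" using gC by simp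
      then show False using v g vG by (simp add: w1_def j m_assoc[symmetric])
    qed
    then have t_fibre: "fibre_map (p ^^ m) w1 w1 (cyc3 0 1 2)"
      using mono[OF w1] w1 by (simp add: s_def)
    have pj: "p ^^ j \<in> carrier ?W" "base_shift G (p ^^ j) = g [^] j"
      using W.nat_pow_closed[OF p(1), of j]
        group_hom.hom_nat_pow[OF group_hom.intro[OF W.group_axioms group_axioms
          group_hom_axioms.intro[OF base_shift_hom]] p(1), of j]
      by (simp_all add: fibred_perms_pow p(2))
    obtain \<tau>1 where "fibre_map y w0 v \<tau>1"
      unfolding v_def by (rule fibre_map_exists[OF yW w0G])
    moreover obtain \<tau>2 where "fibre_map (p ^^ j) v (base_shift G (p ^^ j) \<otimes> v) \<tau>2"
      by (rule fibre_map_exists[OF pj(1) vG])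
    then have "fibre_map (p ^^ j) v w1 \<tau>2"
      by (simp only: pj(2) w1_def j)
    ultimately have "fibre_map (p ^^ j \<circ> y) w0 w1 (\<tau>2 \<circ> \<tau>1)"
      by (rule fibre_map_comp)
    moreover have "p ^^ j \<circ> y \<in> K"
      by (rule Kcomp[OF Kpow[OF pK] yK])
    ultimately obtain q \<tau> where q: "q \<in> K" and q_fibre: "fibre_map q w0 w1 \<tau>"
      by blast
    define c where "c = p ^^ m"
    have cK: "c \<in> K" using Kpow pK by (simp add: c_def)
    define t where "t = finv q \<circ> c \<circ> q"
    have t0: "fibre_map t w0 w0 (finv \<tau> \<circ> cyc3 0 1 2 \<circ> \<tau>)"
      unfolding t_def c_def
      using fibre_map_comp[OF q_fibre fibre_map_comp[OF t_fibre fibre_map_inv[OF Kbij[OF q] q_fibre]]]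
      by (simp add: comp_assoc)
    define P where "P r \<longleftrightarrow> (\<exists>\<sigma>. is_cyc3 \<sigma> \<and> fibre_map r w0 w0 \<sigma>)" for r
    show "\<not> solvable ?H"
    proof (rule H.not_solvable_if_commutators_persist[where P = P])
      show "t \<in> carrier ?H"
        using q cK by (simp add: t_def Kcomp Kinv)
      have "is_cyc3 (cyc3 0 1 2)"
        unfolding is_cyc3_def by (intro exI[of _ 0] exI[of _ 1] exI[of _ 2]) simp
      then have "is_cyc3 (finv \<tau> \<circ> cyc3 0 1 2 \<circ> \<tau>)"
        using q_fibre by (intro is_cyc3_conj) (simp_all add: fibre_map_def)
      then show "P t" using t0 by (auto simp: P_def)
      show "\<not> P \<one>\<^bsub>?H\<^esub>"
        using not_is_cyc3_id
        by (auto simp: P_def fibred_perms_one dest!: fibre_map_unique[OF fibre_map_id])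
    next
      fix r assume rH: "r \<in> carrier ?H" and "P r"
      then have r: "r \<in> K" by simp
      obtain \<sigma> where \<sigma>: "is_cyc3 \<sigma>" "fibre_map r w0 w0 \<sigma>"
        using \<open>P r\<close> by (auto simp: P_def)
      obtain k where k: "is_cyc3 (\<sigma> \<circ> ((cyc5 ^^ k) \<circ> \<sigma> \<circ> finv (cyc5 ^^ k)) \<circ> finv \<sigma>
          \<circ> finv ((cyc5 ^^ k) \<circ> \<sigma> \<circ> finv (cyc5 ^^ k)))"
        using is_cyc3_commutator[OF \<sigma>(1)] .
      define h where "h = c ^^ k"
      define u where "u = h \<circ> r \<circ> finv h"
      have hK: "h \<in> K" using Kpow cK by (simp add: h_def)
      have uK: "u \<in> K" using hK r by (simp add: u_def Kcomp Kinv)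
      have h_fibre: "fibre_map h w0 w0 (cyc5 ^^ k)"
        unfolding h_def
      proof (induction k)
        case 0
        then show ?case by (simp add: fibre_map_id[unfolded id_def] id_def)
      next
        case (Suc k)
        show ?case using fibre_map_comp[OF Suc c_fibre] by (simp only: funpow.simps(2) c_def)
      qed
      have u_fibre: "fibre_map u w0 w0 ((cyc5 ^^ k) \<circ> \<sigma> \<circ> finv (cyc5 ^^ k))"
        unfolding u_def
        by (rule fibre_map_comp[OF fibre_map_inv[OF Kbij[OF hK] h_fibre] fibre_map_comp[OF \<sigma>(2) h_fibre]])
      have "fibre_map (r \<circ> u \<circ> finv r \<circ> finv u) w0 w0
          (\<sigma> \<circ> ((cyc5 ^^ k) \<circ> \<sigma> \<circ> finv (cyc5 ^^ k)) \<circ> finv \<sigma>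
            \<circ> finv ((cyc5 ^^ k) \<circ> \<sigma> \<circ> finv (cyc5 ^^ k)))"
        by (rule fibre_map_comp[OF fibre_map_inv[OF Kbij[OF uK] u_fibre]
              fibre_map_comp[OF fibre_map_inv[OF Kbij[OF r] \<sigma>(2)] fibre_map_comp[OF u_fibre \<sigma>(2)]]])
      then have "P (r \<circ> u \<circ> finv r \<circ> finv u)"
        using k by (auto simp: P_def)
      then show "\<exists>h \<in> carrier ?H. P (r \<otimes>\<^bsub>?H\<^esub> (h \<otimes>\<^bsub>?H\<^esub> r \<otimes>\<^bsub>?H\<^esub> inv\<^bsub>?H\<^esub> h) \<otimes>\<^bsub>?H\<^esub> inv\<^bsub>?H\<^esub> r
          \<otimes>\<^bsub>?H\<^esub> inv\<^bsub>?H\<^esub> (h \<otimes>\<^bsub>?H\<^esub> r \<otimes>\<^bsub>?H\<^esub> inv\<^bsub>?H\<^esub> h))"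
        using hK r uK by (intro bexI[of _ h]) (simp_all add: Hinv fibred_perms_mult u_def[symmetric])
    qed
  qed
qed

end

text \<open>
  No soluble subgroup of \<^term>\<open>G\<close> contains \<^term>\<open>g\<close> together with an element outside \<^term>\<open>A\<close>.
\<close>
definition insoluble_outside :: "('a, 'b) monoid_scheme \<Rightarrow> 'a \<Rightarrow> 'a set \<Rightarrow> bool" where
  "insoluble_outside G g A \<longleftrightarrow>
    (\<forall>y \<in> carrier G - A. \<forall>K. subgroup K G \<longrightarrow> {g, y} \<subseteq> K \<longrightarrow> \<not> solvable (G\<lparr>carrier := K\<rparr>))"

lemma insoluble_outsideD:
  assumes "insoluble_outside G g A" "subgroup K G" "solvable (G\<lparr>carrier := K\<rparr>)" "g \<in> K"
  shows "K \<subseteq> A"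
  using assms subgroup.subset[OF assms(2)] unfolding insoluble_outside_def by blast

text \<open>
  The inductive step with the new group transported along an injection into the natural numbers, so
  that it can be iterated within one type.
\<close>
lemma insoluble_lift_nat:
  assumes "group G" and fin: "finite (carrier G)" and g: "g \<in> carrier G"
  obtains G' :: "nat monoid" and g' \<pi> where "group G'" "finite (carrier G')" "g' \<in> carrier G'"
    "\<pi> \<in> hom G' G" "\<pi> ` carrier G' = carrier G" "\<pi> g' = g"
    "insoluble_outside G' g' {y. \<pi> y \<in> generate G {g}}"
proof -
  interpret group G by fact
  let ?W = "fibred_perms G"
  interpret W: group ?W by (rule fibred_perms_group)
  have finW: "finite (carrier ?W)" using fin by (rule finite_fibred_perms)
  obtain p where p: "p \<in> carrier ?W" "base_shift G p = g"
    and ins: "\<And>y K. base_shift G y \<notin> generate G {g} \<Longrightarrow> subgroup K ?W \<Longrightarrow> p \<in> K \<Longrightarrow> y \<in> K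
      \<Longrightarrow> \<not> solvable (?W\<lparr>carrier := K\<rparr>)"
    using insoluble_lift_exists[OF fin g] by blast
  obtain f :: "_ \<Rightarrow> nat" where f: "inj_on f (carrier ?W)"
    using finite_imp_inj_to_nat_seg[OF finW] by blast
  define G' where "G' = image_group f ?W"
  define \<psi> where "\<psi> = inv_into (carrier ?W) f"
  interpret G': group G'
    unfolding G'_def by (rule W.inj_imp_image_group_is_group[OF f])
  have \<psi>: "\<psi> \<in> iso G' ?W"
    unfolding \<psi>_def G'_def by (rule W.iso_set_sym[OF inj_imp_image_group_iso[OF f]])
  then have \<psi>_hom: "\<psi> \<in> hom G' ?W" and \<psi>_img: "\<psi> ` carrier G' = carrier ?W"
    by (auto simp: iso_def bij_betw_def)
  have carrier': "carrier G' = f ` carrier ?W"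
    by (simp add: G'_def image_group_carrier)
  have \<psi>_f: "\<psi> (f q) = q" if "q \<in> carrier ?W" for q
    using that f by (simp add: \<psi>_def)
  let ?\<pi> = "base_shift G \<circ> \<psi>"
  show thesis
  proof (rule that[of G' "f p" ?\<pi>])
    show "group G'" by (rule G'.group_axioms)
    show "finite (carrier G')" using finW by (simp add: carrier')
    show "f p \<in> carrier G'" using p by (simp add: carrier')
    show "?\<pi> \<in> hom G' G" by (rule Group.hom_compose[OF \<psi>_hom base_shift_hom])
    show "?\<pi> ` carrier G' = carrier G"
      unfolding image_comp[symmetric] \<psi>_img by (rule base_shift_surj)
    show "?\<pi> (f p) = g" using p \<psi>_f by simp
    show "insoluble_outside G' (f p) {y. ?\<pi> y \<in> generate G {g}}"
      unfolding insoluble_outside_def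
    proof (intro ballI allI impI notI)
      fix y K
      assume y: "y \<in> carrier G' - {y. ?\<pi> y \<in> generate G {g}}"
        and K: "subgroup K G'" "{f p, y} \<subseteq> K" and sol: "solvable (G'\<lparr>carrier := K\<rparr>)"
      interpret \<psi>: group_hom G' ?W \<psi>
        by unfold_locales (rule \<psi>_hom)
      have sub: "subgroup (\<psi> ` K) ?W" using \<psi>.subgroup_img_is_subgroup[OF K(1)] .
      interpret K\<psi>: group_hom "G'\<lparr>carrier := K\<rparr>" "?W\<lparr>carrier := \<psi> ` K\<rparr>" \<psi>
      proof (intro group_hom.intro group_hom_axioms.intro)
        show "group (G'\<lparr>carrier := K\<rparr>)"
          using K(1) G'.group_axioms by (rule subgroup.subgroup_is_group)
        show "group (?W\<lparr>carrier := \<psi> ` K\<rparr>)"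
          using sub W.group_axioms by (rule subgroup.subgroup_is_group)
        show "\<psi> \<in> hom (G'\<lparr>carrier := K\<rparr>) (?W\<lparr>carrier := \<psi> ` K\<rparr>)"
          using subgroup.subset[OF K(1)] by (auto simp: hom_def subset_iff)
      qed
      have "solvable (?W\<lparr>carrier := \<psi> ` K\<rparr>)"
        by (rule K\<psi>.surj_hom_imp_solvable) (simp_all add: sol)
      moreover have "\<psi> y \<in> \<psi> ` K" "p \<in> \<psi> ` K"
        using K(2) \<psi>_f[OF p(1)] by (auto simp: image_iff) metis
      ultimately show False
        using ins[OF _ sub, of "\<psi> y"] y by simp
    qed
  qed
qed

section \<open>Profinite and prosoluble groups\<close>

lemma (in comm_group) comm_group_solvable: "solvable G"
proof -
  have "(derived G ^^ 1) (carrier G) = {\<one>}" by (simp add: derived_eq_singleton)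
  then show ?thesis unfolding solvable_iff_trivial_derived_seq by blast
qed

lemma profinite_group_closed_subgroup:
  fixes G (structure)
  assumes "profinite_group G T" and H: "subgroup H G" and cl: "closedin T H"
  shows "profinite_group (G\<lparr>carrier := H\<rparr>) (subtopology T H)"
proof -
  interpret profinite_group G T by fact
  interpret H: subgroup H G by fact
  interpret HG: group "G\<lparr>carrier := H\<rparr>" by (rule H.subgroup_is_group) (rule group_axioms)
  have top: "topspace (subtopology T H) = H"
    using H.subset topspace_eq by auto
  show ?thesis
  proof unfold_locales
    show "topspace (subtopology T H) = carrier (G\<lparr>carrier := H\<rparr>)" by (simp add: top[simplified])
    have "continuous_map (subtopology (prod_topology T T) (H \<times> H)) (subtopology T H) (\<lambda>(x, y). x \<otimes> y)"
      using continuous_mult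
      by (intro continuous_map_into_subtopology continuous_map_from_subtopology) auto
    then show "continuous_map (prod_topology (subtopology T H) (subtopology T H)) (subtopology T H)
        (\<lambda>(x, y). x \<otimes>\<^bsub>G\<lparr>carrier := H\<rparr>\<^esub> y)"
      by (simp add: subtopology_Times)
    have "continuous_map (subtopology T H) (subtopology T H) (\<lambda>x. inv x)"
      using continuous_inv
      by (intro continuous_map_into_subtopology continuous_map_from_subtopology) auto
    then show "continuous_map (subtopology T H) (subtopology T H) (\<lambda>x. inv\<^bsub>G\<lparr>carrier := H\<rparr>\<^esub> x)"
      by (rule continuous_map_eq) (use m_inv_consistent[OF H] in auto)
    show "compact_space (subtopology T H)"
      using closedin_compact_space[OF compact cl] by (rule compact_space_subtopology)
    show "Hausdorff_space (subtopology T H)"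
      using Hausdorff by (rule Hausdorff_space_subtopology)
    show "totally_disconnected_space (subtopology T H)"
      unfolding totally_disconnected_space_def
    proof
      fix x assume x: "x \<in> topspace (subtopology T H)"
      then have "connected_component_of_set T x = {x}"
        using totally_disconnected by (simp add: totally_disconnected_space_def)
      moreover have "connected_component_of_set (subtopology T H) x \<subseteq> connected_component_of_set T x"
        using connected_component_of_mono[of T H x _ "topspace T"]
        by (auto simp: subtopology_topspace connected_component_of_def connectedin_subtopology)
      moreover have "x \<in> connected_component_of_set (subtopology T H) x"
        using x by (simp add: connected_component_of_refl)
      ultimately show "connected_component_of_set (subtopology T H) x = {x}" by blast
    qed
  qed
qed

lemma profinite_group_product:
  assumes grp: "\<And>i. i \<in> I \<Longrightarrow> group (G i)" and fin: "\<And>i. i \<in> I \<Longrightarrow> finite (carrier (G i))"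
  shows "profinite_group (product_group I G) (product_topology (\<lambda>i. discrete_topology (carrier (G i))) I)"
    (is "profinite_group ?P ?T")
proof -
  interpret P: group ?P by (rule product_group) (rule grp)
  have proj: "continuous_map ?T (discrete_topology (carrier (G i))) (\<lambda>x. x i)" if "i \<in> I" for i
    using continuous_map_product_projection[OF that] by fastforce
  show ?thesis
  proof unfold_locales
    show "topspace ?T = carrier ?P" by simp
    show "continuous_map (prod_topology ?T ?T) ?T (\<lambda>(x, y). x \<otimes>\<^bsub>?P\<^esub> y)"
      unfolding continuous_map_componentwise
    proof (intro conjI ballI)
      show "(\<lambda>(x, y). x \<otimes>\<^bsub>?P\<^esub> y) ` topspace (prod_topology ?T ?T) \<subseteq> extensional I"
        by auto
      fix i assume i: "i \<in> I"
      let ?D = "discrete_topology (carrier (G i))"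
      have "continuous_map (prod_topology ?T ?T) (prod_topology ?D ?D) (\<lambda>z. (fst z i, snd z i))"
        using continuous_map_compose[OF continuous_map_fst[of ?T ?T] proj[OF i]]
          continuous_map_compose[OF continuous_map_snd[of ?T ?T] proj[OF i]]
        by (simp add: continuous_map_pairwise o_def)
      moreover have "continuous_map (prod_topology ?D ?D) ?D (\<lambda>(x, y). x \<otimes>\<^bsub>G i\<^esub> y)"
        using monoid.m_closed[OF group.is_monoid[OF grp[OF i]]]
        by (auto simp: prod_topology_discrete_topology[symmetric])
      ultimately have "continuous_map (prod_topology ?T ?T) ?D
          ((\<lambda>(x, y). x \<otimes>\<^bsub>G i\<^esub> y) \<circ> (\<lambda>z. (fst z i, snd z i)))"
        by (rule continuous_map_compose)
      then show "continuous_map (prod_topology ?T ?T) ?D (\<lambda>z. (\<lambda>(x, y). x \<otimes>\<^bsub>?P\<^esub> y) z i)"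
        by (rule continuous_map_eq) (use i in auto)
    qed
    show "continuous_map ?T ?T (\<lambda>x. inv\<^bsub>?P\<^esub> x)"
      unfolding continuous_map_componentwise
    proof (intro conjI ballI)
      show "(\<lambda>x. inv\<^bsub>?P\<^esub> x) ` topspace ?T \<subseteq> extensional I"
        using P.inv_closed by (auto simp: PiE_def)
      fix i assume i: "i \<in> I"
      let ?D = "discrete_topology (carrier (G i))"
      have "continuous_map ?D ?D (\<lambda>x. inv\<^bsub>G i\<^esub> x)"
        using group.inv_closed[OF grp[OF i]] by auto
      then have "continuous_map ?T ?D ((\<lambda>x. inv\<^bsub>G i\<^esub> x) \<circ> (\<lambda>x. x i))"
        by (rule continuous_map_compose[OF proj[OF i]])
      then show "continuous_map ?T ?D (\<lambda>x. (inv\<^bsub>?P\<^esub> x) i)"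
        by (rule continuous_map_eq) (use i grp in \<open>auto simp: inv_product_group\<close>)
    qed
    show "compact_space ?T"
      by (simp add: compact_space_product_topology compact_space_discrete_topology fin)
    show "Hausdorff_space ?T"
      by (simp add: Hausdorff_space_product_topology)
    show "totally_disconnected_space ?T"
      unfolding totally_disconnected_space_def
    proof
      fix x assume x: "x \<in> topspace ?T"
      have "y = x" if xy: "connected_component_of ?T x y" for y
      proof -
        obtain S where S: "connectedin ?T S" "x \<in> S" "y \<in> S"
          using xy by (auto simp: connected_component_of_def)
        have y: "y \<in> topspace ?T" using S connectedin_subset_topspace by blast
        have "y i = x i" if i: "i \<in> I" for i
        proof -
          have "connectedin (discrete_topology (carrier (G i))) ((\<lambda>x. x i) ` S)"
            by (rule connectedin_continuous_map_image[OF proj[OF i] S(1)])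
          then obtain a where "(\<lambda>x. x i) ` S \<subseteq> {a}" by (auto simp: connectedin_discrete_topology)
          then show ?thesis using S by auto
        qed
        then show "y = x" using x y by (auto intro: PiE_ext)
      qed
      then show "connected_component_of_set ?T x = {x}"
        using x connected_component_of_refl[of ?T x] by blast
    qed
  qed
qed

lemma
  assumes "profinite_group G T" "S \<subseteq> carrier G"
  shows closed_subgroup_generated_subgroup: "subgroup (closed_subgroup_generated G T S) G"
    and closed_subgroup_generated_closedin: "closedin T (closed_subgroup_generated G T S)"
    and closed_subgroup_generated_incl: "S \<subseteq> closed_subgroup_generated G T S"
proof -
  interpret profinite_group G T by fact
  let ?F = "{H. subgroup H G \<and> closedin T H \<and> S \<subseteq> H}"
  have "carrier G \<in> ?F"
    using assms(2) subgroup_self closedin_topspace[of T] by (simp add: topspace_eq)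
  then have "?F \<noteq> {}" by blast
  then show "subgroup (closed_subgroup_generated G T S) G" "closedin T (closed_subgroup_generated G T S)"
    unfolding closed_subgroup_generated_def
    by (auto intro: subgroups_Inter closedin_Inter)
  show "S \<subseteq> closed_subgroup_generated G T S"
    by (auto simp: closed_subgroup_generated_def)
qed

lemma closed_subgroup_generated_minimal:
  assumes "subgroup H G" "closedin T H" "S \<subseteq> H"
  shows "closed_subgroup_generated G T S \<subseteq> H"
  using assms by (auto simp: closed_subgroup_generated_def)

lemma prosoluble_group_comm:
  assumes "profinite_group G T" "comm_group G"
  shows "prosoluble_group G T"
proof -
  interpret comm_group G by fact
  show ?thesis
    using assms(1) abelian_FactGroup comm_group.comm_group_solvable normal_imp_subgroup
    by (auto intro!: prosoluble_group.intro prosoluble_group_axioms.intro)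
qed

lemma prosoluble_group_image_solvable:
  assumes "prosoluble_group G T" "group_hom G F h" "openin T (kernel G F h)"
  shows "solvable (F\<lparr>carrier := h ` carrier G\<rparr>)"
proof -
  interpret prosoluble_group G T by fact
  interpret h: group_hom G F h by fact
  let ?F = "F\<lparr>carrier := h ` carrier G\<rparr>"
  have F: "group ?F"
    using h.img_is_subgroup h.H.group_axioms by (rule subgroup.subgroup_is_group)
  interpret h': group_hom G ?F h
  proof (intro group_hom.intro group_hom_axioms.intro group_axioms F)
    show "h \<in> hom G ?F" by (auto simp: hom_def)
  qed
  have k: "kernel G ?F h = kernel G F h" by (simp add: kernel_def)
  interpret N: normal "kernel G ?F h" G by (rule h'.normal_kernel)
  have "solvable (G Mod kernel G ?F h)"
    using solvable_quotients[OF h'.normal_kernel] assms(3) k by simp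
  moreover have "(\<lambda>X. the_elem (h ` X)) \<in> iso (G Mod kernel G ?F h) ?F"
    by (rule h'.FactGroup_iso_set) simp
  ultimately show ?thesis
    by (intro group_hom.surj_hom_imp_solvable[of "G Mod kernel G ?F h" ?F "\<lambda>X. the_elem (h ` X)"]
        group_hom.intro group_hom_axioms.intro N.factorgroup_is_group F)
      (auto simp: iso_def bij_betw_def)
qed

section \<open>Inverse limits of towers of finite groups\<close>

text \<open>
  An inverse system of finite groups over the natural numbers with surjective bonding maps \<open>\<pi>\<close> and a
  compatible family \<open>g\<close> of elements.
\<close>
locale finite_group_tower =
  fixes G :: "nat \<Rightarrow> 'a monoid" and g :: "nat \<Rightarrow> 'a" and \<pi> :: "nat \<Rightarrow> 'a \<Rightarrow> 'a"
  assumes group_tower: "group (G n)" and finite_tower: "finite (carrier (G n))"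
    and g_mem: "g n \<in> carrier (G n)"
    and \<pi>_hom: "\<pi> n \<in> hom (G (Suc n)) (G n)" and \<pi>_surj: "\<pi> n ` carrier (G (Suc n)) = carrier (G n)"
    and \<pi>_g: "\<pi> n (g (Suc n)) = g n"
begin

abbreviation ambient_group :: "(nat \<Rightarrow> 'a) monoid" where "ambient_group \<equiv> product_group UNIV G"
abbreviation ambient_topology :: "(nat \<Rightarrow> 'a) topology" where
  "ambient_topology \<equiv> product_topology (\<lambda>n. discrete_topology (carrier (G n))) UNIV"

text \<open>
  The underlying set of the inverse limit.
\<close>
definition threads :: "(nat \<Rightarrow> 'a) set" where
  "threads = {x. \<forall>n. x n \<in> carrier (G n) \<and> \<pi> n (x (Suc n)) = x n}"

text \<open>
  The inverse limit, as a closed subgroup of the product of the discrete groups.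
\<close>
definition limit_group :: "(nat \<Rightarrow> 'a) monoid" where "limit_group = ambient_group\<lparr>carrier := threads\<rparr>"
definition limit_topology :: "(nat \<Rightarrow> 'a) topology" where "limit_topology = subtopology ambient_topology threads"

lemma profinite_ambient: "profinite_group ambient_group ambient_topology"
  using group_tower finite_tower by (intro profinite_group_product)

lemma subgroup_threads: "subgroup threads ambient_group"
proof -
  interpret P: profinite_group ambient_group ambient_topology by (rule profinite_ambient)
  interpret \<pi>: group_hom "G (Suc n)" "G n" "\<pi> n" for n
    by (intro group_hom.intro group_hom_axioms.intro group_tower \<pi>_hom)
  show ?thesis
  proof (rule P.subgroupI)
    show "threads \<subseteq> carrier ambient_group" by (auto simp: threads_def)
    have "g \<in> threads" using g_mem \<pi>_g by (simp add: threads_def)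
    then show "threads \<noteq> {}" by blast
  next
    fix x assume x: "x \<in> threads"
    then have "x \<in> (\<Pi>\<^sub>E i\<in>UNIV. carrier (G i))" by (simp add: threads_def PiE_iff)
    then have "inv\<^bsub>ambient_group\<^esub> x = (\<lambda>i. inv\<^bsub>G i\<^esub> x i)"
      using inv_product_group[of x UNIV G] group_tower by (simp add: restrict_def)
    then show "inv\<^bsub>ambient_group\<^esub> x \<in> threads"
      using x by (simp add: threads_def)
  next
    fix x y assume "x \<in> threads" "y \<in> threads"
    then show "x \<otimes>\<^bsub>ambient_group\<^esub> y \<in> threads" by (simp add: threads_def)
  qed
qed

lemma projection_continuous_ambient: "continuous_map ambient_topology (discrete_topology (carrier (G n))) (\<lambda>x. x n)"
  using continuous_map_product_projection[of n UNIV "\<lambda>n. discrete_topology (carrier (G n))"] by simp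

lemma closedin_threads: "closedin ambient_topology threads"
proof -
  have "closedin ambient_topology {x \<in> topspace ambient_topology. \<pi> n (x (Suc n)) = x n}" for n
  proof (rule closedin_continuous_maps_eq)
    have "continuous_map (discrete_topology (carrier (G (Suc n)))) (discrete_topology (carrier (G n))) (\<pi> n)"
      using \<pi>_surj[of n] by auto
    from continuous_map_compose[OF projection_continuous_ambient this]
    show "continuous_map ambient_topology (discrete_topology (carrier (G n))) (\<lambda>x. \<pi> n (x (Suc n)))"
      by (simp add: o_def)
  qed (auto intro: projection_continuous_ambient)
  then have "closedin ambient_topology (\<Inter>n. {x \<in> topspace ambient_topology. \<pi> n (x (Suc n)) = x n})"
    by (intro closedin_Inter) auto
  moreover have "(\<Inter>n. {x \<in> topspace ambient_topology. \<pi> n (x (Suc n)) = x n}) = threads"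
    by (auto simp: threads_def PiE_iff)
  ultimately show ?thesis by simp
qed

lemma profinite_limit: "profinite_group limit_group limit_topology"
  unfolding limit_group_def limit_topology_def
  by (rule profinite_group_closed_subgroup[OF profinite_ambient subgroup_threads closedin_threads])

sublocale L: profinite_group limit_group limit_topology
  by (rule profinite_limit)

lemma carrier_limit: "carrier limit_group = threads" and mult_limit: "x \<otimes>\<^bsub>limit_group\<^esub> y = (\<lambda>n. x n \<otimes>\<^bsub>G n\<^esub> y n)"
  by (simp_all add: limit_group_def restrict_def)

lemma thread_component: "x \<in> carrier limit_group \<Longrightarrow> x n \<in> carrier (G n)"
  by (simp add: carrier_limit threads_def)

lemma projection_hom: "group_hom limit_group (G n) (\<lambda>x. x n)"
  by (intro group_hom.intro group_hom_axioms.intro L.group_axioms group_tower)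
    (simp add: hom_def thread_component mult_limit)

lemma projection_continuous: "continuous_map limit_topology (discrete_topology (carrier (G n))) (\<lambda>x. x n)"
  unfolding limit_topology_def by (intro continuous_map_from_subtopology projection_continuous_ambient)

lemma thread_determines_below:
  assumes x: "x \<in> carrier limit_group" and y: "y \<in> carrier limit_group" and "x n = y n" "i \<le> n"
  shows "x i = y i"
  using \<open>i \<le> n\<close>
proof (induction i rule: inc_induct)
  case base
  then show ?case by fact
next
  case (step i)
  have "x i = \<pi> i (x (Suc i))" "y i = \<pi> i (y (Suc i))"
    using x y by (auto simp: carrier_limit threads_def)
  then show ?case using step by simp
qed

lemma thread_through:
  assumes "a \<in> carrier (G 0)"
  obtains x where "x \<in> carrier limit_group" "x 0 = a"
proof -
  have "\<exists>x. \<forall>n. (x n \<in> carrier (G n) \<and> (n = 0 \<longrightarrow> x n = a)) \<and> \<pi> n (x (Suc n)) = x n"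
  proof (rule dependent_nat_choice)
    fix b n assume "b \<in> carrier (G n) \<and> (n = 0 \<longrightarrow> b = a)"
    then have "b \<in> \<pi> n ` carrier (G (Suc n))" using \<pi>_surj by simp
    then show "\<exists>c. (c \<in> carrier (G (Suc n)) \<and> (Suc n = 0 \<longrightarrow> c = a)) \<and> \<pi> n c = b" by auto
  qed (use assms in auto)
  then show thesis using that by (auto simp: carrier_limit threads_def)
qed

lemma g_in_limit: "g \<in> carrier limit_group"
  using g_mem \<pi>_g by (simp add: carrier_limit threads_def)

text \<open>
  The threads whose every component is a power of the corresponding component of \<open>g\<close>; the exponent may
  depend on the level.
\<close>
definition levelwise_powers :: "(nat \<Rightarrow> 'a) set" where
  "levelwise_powers = {x \<in> carrier limit_group. \<forall>n. x n \<in> generate (G n) {g n}}"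

lemma subgroup_generate_g: "subgroup (generate (G n) {g n}) (G n)"
  using group.generate_is_subgroup[OF group_tower] g_mem by simp

lemma subgroup_levelwise_powers: "subgroup levelwise_powers limit_group"
proof (rule L.subgroupI)
  show "levelwise_powers \<subseteq> carrier limit_group" by (auto simp: levelwise_powers_def)
  have "g \<in> levelwise_powers"
    using g_in_limit by (auto simp: levelwise_powers_def intro: generate.incl)
  then show "levelwise_powers \<noteq> {}" by blast
next
  fix x assume x: "x \<in> levelwise_powers"
  then have "(inv\<^bsub>limit_group\<^esub> x) n = inv\<^bsub>G n\<^esub> x n" for n
    using group_hom.hom_inv[OF projection_hom] by (auto simp: levelwise_powers_def)
  then show "inv\<^bsub>limit_group\<^esub> x \<in> levelwise_powers"
    using x subgroup.m_inv_closed[OF subgroup_generate_g] by (auto simp: levelwise_powers_def)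
next
  fix x y assume "x \<in> levelwise_powers" "y \<in> levelwise_powers"
  then show "x \<otimes>\<^bsub>limit_group\<^esub> y \<in> levelwise_powers"
    using subgroup.m_closed[OF subgroup_generate_g] L.m_closed[of x y]
    by (auto simp: levelwise_powers_def mult_limit)
qed

lemma closedin_levelwise_powers: "closedin limit_topology levelwise_powers"
proof -
  have "closedin limit_topology {x \<in> topspace limit_topology. x n \<in> generate (G n) {g n}}" for n
    using subgroup.subset[OF subgroup_generate_g]
    by (intro closedin_continuous_map_preimage[OF projection_continuous]) simp
  then have "closedin limit_topology (\<Inter>n. {x \<in> topspace limit_topology. x n \<in> generate (G n) {g n}})"
    by (intro closedin_Inter) auto
  moreover have "(\<Inter>n. {x \<in> topspace limit_topology. x n \<in> generate (G n) {g n}}) = levelwise_powers"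
    by (auto simp: levelwise_powers_def L.topspace_eq)
  ultimately show ?thesis by simp
qed

lemma levelwise_power:
  assumes "x \<in> levelwise_powers"
  obtains k :: int where "x n = g n [^]\<^bsub>G n\<^esub> k"
proof -
  have "x n \<in> generate (G n) {g n}" using assms by (simp add: levelwise_powers_def)
  then show thesis
    using that unfolding group.generate_pow[OF group_tower g_mem] by blast
qed

lemma levelwise_powers_commute:
  assumes "x \<in> levelwise_powers" "y \<in> levelwise_powers"
  shows "x \<otimes>\<^bsub>limit_group\<^esub> y = y \<otimes>\<^bsub>limit_group\<^esub> x"
proof
  fix n
  obtain k l :: int where "x n = g n [^]\<^bsub>G n\<^esub> k" "y n = g n [^]\<^bsub>G n\<^esub> l"
    using levelwise_power[OF assms(1)] levelwise_power[OF assms(2)] by metis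
  then show "(x \<otimes>\<^bsub>limit_group\<^esub> y) n = (y \<otimes>\<^bsub>limit_group\<^esub> x) n"
    unfolding mult_limit by (metis add.commute group.int_pow_mult[OF group_tower g_mem])
qed

text \<open>
  A component of a thread determines all lower ones, so an element of \<^const>\<open>levelwise_powers\<close> agrees
  with a single power of \<open>g\<close> up to any prescribed level and hence lies in the closure of the powers of \<open>g\<close>.
\<close>
lemma closed_subgroup_generated_g: "closed_subgroup_generated limit_group limit_topology {g} = levelwise_powers"
proof
  have "g \<in> levelwise_powers"
    using g_in_limit by (auto simp: levelwise_powers_def intro: generate.incl)
  then show "closed_subgroup_generated limit_group limit_topology {g} \<subseteq> levelwise_powers"
    using subgroup_levelwise_powers closedin_levelwise_powers
    by (intro closed_subgroup_generated_minimal) auto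
  show "levelwise_powers \<subseteq> closed_subgroup_generated limit_group limit_topology {g}"
    unfolding closed_subgroup_generated_def
  proof (intro subsetI InterI, clarify)
    fix x H assume x: "x \<in> levelwise_powers" and H: "subgroup H limit_group" "closedin limit_topology H" and "{g} \<subseteq> H"
    have xL: "x \<in> carrier limit_group" using x by (simp add: levelwise_powers_def)
    have "x \<in> limit_topology closure_of H"
      unfolding in_closure_of
    proof (intro conjI allI impI)
      show "x \<in> topspace limit_topology" using xL L.topspace_eq by simp
      fix U assume "x \<in> U \<and> openin limit_topology U"
      then obtain V where V: "openin ambient_topology V" "U = V \<inter> threads" "x \<in> V"
        unfolding limit_topology_def by (auto simp: openin_subtopology)
      obtain X where X: "x \<in> (\<Pi>\<^sub>E i\<in>UNIV. X i)" "(\<Pi>\<^sub>E i\<in>UNIV. X i) \<subseteq> V"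
          "finite {i. X i \<noteq> topspace (discrete_topology (carrier (G i)))}"
        using product_topology_open_contains_basis[OF V(1,3)] by blast
      obtain n where n: "\<And>i. X i \<noteq> carrier (G i) \<Longrightarrow> i \<le> n"
        using X(3) unfolding finite_nat_set_iff_bounded_le by auto
      obtain k :: int where k: "x n = g n [^]\<^bsub>G n\<^esub> k" using levelwise_power[OF x] .
      define y where "y = g [^]\<^bsub>limit_group\<^esub> k"
      have yL: "y \<in> carrier limit_group" unfolding y_def using g_in_limit by (rule L.int_pow_closed)
      have "y n = x n"
        unfolding y_def k using group_hom.hom_int_pow[OF projection_hom g_in_limit] by blast
      then have below: "y i = x i" if "i \<le> n" for i
        using thread_determines_below[OF yL xL _ that] by blast
      have "y i \<in> X i" for i
      proof (cases "i \<le> n")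
        case True
        then show ?thesis using below X(1) by auto
      next
        case False
        then show ?thesis using n[of i] thread_component[OF yL, of i] by auto
      qed
      then have "y \<in> U" using X(2) V(2) yL by (auto simp: carrier_limit)
      moreover have "y \<in> H"
        unfolding y_def using \<open>{g} \<subseteq> H\<close> H(1) by (simp add: L.subgroup_int_pow_closed)
      ultimately show "\<exists>y. y \<in> H \<and> y \<in> U" by blast
    qed
    then show "x \<in> H" using H(2) by (simp add: closure_of_closedin)
  qed
qed

text \<open>
  The image of a prosoluble \<open>K\<close> at level \<open>Suc n\<close> is soluble, being the quotient of \<open>K\<close> by an open normal
  subgroup; this forces the components at level \<open>n\<close> to be powers of \<open>g n\<close>.
\<close>
lemma closed_subgroup_levelwise:
  assumes ins: "\<And>n. insoluble_outside (G (Suc n)) (g (Suc n)) {y. \<pi> n y \<in> generate (G n) {g n}}"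
    and K: "subgroup K limit_group" "g \<in> K"
    and sol: "prosoluble_group (limit_group\<lparr>carrier := K\<rparr>) (subtopology limit_topology K)"
  shows "K \<subseteq> levelwise_powers"
proof
  fix y assume y: "y \<in> K"
  then have yL: "y \<in> carrier limit_group" using subgroup.subset[OF K(1)] by auto
  have "y n \<in> generate (G n) {g n}" for n
  proof -
    let ?h = "\<lambda>x::nat \<Rightarrow> 'a. x (Suc n)"
    have KL: "group (limit_group\<lparr>carrier := K\<rparr>)"
      using K(1) L.group_axioms by (rule subgroup.subgroup_is_group)
    have hom: "group_hom (limit_group\<lparr>carrier := K\<rparr>) (G (Suc n)) ?h"
      using subgroup.subset[OF K(1)]
      by (intro group_hom.intro group_hom_axioms.intro KL group_tower)
        (auto simp: hom_def mult_limit thread_component)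
    have "openin (subtopology limit_topology K)
        {x \<in> topspace (subtopology limit_topology K). ?h x \<in> {\<one>\<^bsub>G (Suc n)\<^esub>}}"
      using projection_continuous[of "Suc n"] group.is_monoid[OF group_tower, of "Suc n"]
      by (intro openin_continuous_map_preimage continuous_map_from_subtopology) auto
    moreover have "{x \<in> topspace (subtopology limit_topology K). ?h x \<in> {\<one>\<^bsub>G (Suc n)\<^esub>}}
        = kernel (limit_group\<lparr>carrier := K\<rparr>) (G (Suc n)) ?h"
      using subgroup.subset[OF K(1)] by (auto simp: kernel_def L.topspace_eq)
    ultimately have "solvable (G (Suc n)\<lparr>carrier := ?h ` K\<rparr>)"
      using prosoluble_group_image_solvable[OF sol hom] by simp
    moreover have "subgroup (?h ` K) (G (Suc n))"
      using group_hom.subgroup_img_is_subgroup[OF projection_hom K(1)] .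
    ultimately have "?h ` K \<subseteq> {y. \<pi> n y \<in> generate (G n) {g n}}"
      using insoluble_outsideD[OF ins] K(2) by blast
    then have "\<pi> n (y (Suc n)) \<in> generate (G n) {g n}" using y by blast
    then show ?thesis using yL by (simp add: carrier_limit threads_def)
  qed
  then show "y \<in> levelwise_powers" using yL by (simp add: levelwise_powers_def)
qed

lemma solubilizer_g:
  assumes ins: "\<And>n. insoluble_outside (G (Suc n)) (g (Suc n)) {y. \<pi> n y \<in> generate (G n) {g n}}"
  shows "solubilizer limit_group limit_topology g = closed_subgroup_generated limit_group limit_topology {g}"
  unfolding closed_subgroup_generated_g
proof
  show "solubilizer limit_group limit_topology g \<subseteq> levelwise_powers"
  proof
    fix y assume "y \<in> solubilizer limit_group limit_topology g"
    define K where "K = closed_subgroup_generated limit_group limit_topology {g, y}"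
    have y: "y \<in> carrier limit_group" and sol: "prosoluble_group (limit_group\<lparr>carrier := K\<rparr>) (subtopology limit_topology K)"
      using \<open>y \<in> solubilizer limit_group limit_topology g\<close> by (simp_all add: solubilizer_def K_def Let_def)
    have "subgroup K limit_group" "{g, y} \<subseteq> K"
      unfolding K_def
      using y g_in_limit closed_subgroup_generated_subgroup[OF profinite_limit, of "{g, y}"]
        closed_subgroup_generated_incl[OF profinite_limit, of "{g, y}"] by auto
    then show "y \<in> levelwise_powers"
      using closed_subgroup_levelwise[OF ins _ _ sol] by auto
  qed
  show "levelwise_powers \<subseteq> solubilizer limit_group limit_topology g"
  proof
    fix y assume y: "y \<in> levelwise_powers"
    then have yL: "y \<in> carrier limit_group" by (simp add: levelwise_powers_def)
    define K where "K = closed_subgroup_generated limit_group limit_topology {g, y}"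
    have K: "subgroup K limit_group" "closedin limit_topology K"
      unfolding K_def using g_in_limit yL
        closed_subgroup_generated_subgroup[OF profinite_limit, of "{g, y}"]
        closed_subgroup_generated_closedin[OF profinite_limit, of "{g, y}"] by auto
    have "g \<in> levelwise_powers"
      using g_in_limit by (auto simp: levelwise_powers_def intro: generate.incl)
    then have "K \<subseteq> levelwise_powers"
      unfolding K_def using y subgroup_levelwise_powers closedin_levelwise_powers
      by (intro closed_subgroup_generated_minimal) auto
    then have "comm_group (limit_group\<lparr>carrier := K\<rparr>)"
      using subgroup.subgroup_is_group[OF K(1) L.group_axioms] levelwise_powers_commute
      by (intro group.group_comm_groupI) auto
    then have "prosoluble_group (limit_group\<lparr>carrier := K\<rparr>) (subtopology limit_topology K)"
      using profinite_group_closed_subgroup[OF profinite_limit K] by (rule prosoluble_group_comm[rotated])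
    then show "y \<in> solubilizer limit_group limit_topology g"
      using yL by (simp add: solubilizer_def K_def Let_def)
  qed
qed

lemma not_prosoluble_limit:
  assumes ins: "\<And>n. insoluble_outside (G (Suc n)) (g (Suc n)) {y. \<pi> n y \<in> generate (G n) {g n}}"
    and proper: "generate (G 0) {g 0} \<noteq> carrier (G 0)"
  shows "\<not> prosoluble_group limit_group limit_topology"
proof
  assume "prosoluble_group limit_group limit_topology"
  moreover have "subtopology limit_topology (carrier limit_group) = limit_topology"
    by (metis L.topspace_eq subtopology_topspace)
  ultimately have "carrier limit_group \<subseteq> levelwise_powers"
    using closed_subgroup_levelwise[OF ins L.subgroup_self g_in_limit] by simp
  moreover obtain a where a: "a \<in> carrier (G 0)" "a \<notin> generate (G 0) {g 0}"
    using proper subgroup.subset[OF subgroup_generate_g[of 0]] by blast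
  obtain x where "x \<in> carrier limit_group" "x 0 = a"
    using thread_through[OF a(1)] .
  ultimately show False
    using a(2) unfolding levelwise_powers_def by blast
qed

end

section \<open>The tower with small solubilizer\<close>

lemma group_two: "group \<lparr>carrier = {0, 1::nat}, monoid.mult = (\<lambda>x y. (x + y) mod 2), one = 0\<rparr>"
  by (rule groupI) auto

theorem proposition6:
  shows "\<exists>(G :: (nat \<Rightarrow> nat) monoid) (T :: (nat \<Rightarrow> nat) topology).
           profinite_group G T \<and> \<not> prosoluble_group G T \<and>
           (\<exists>g \<in> carrier G. solubilizer G T g = closed_subgroup_generated G T {g})"
proof -
  \<comment> \<open>The tower starts with the group of order 2 and its identity element, which does not generate it.\<close>
  define Z :: "nat monoid" where
    "Z = \<lparr>carrier = {0, 1}, monoid.mult = (\<lambda>x y. (x + y) mod 2), one = 0\<rparr>"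
  have Z: "group Z" "finite (carrier Z)" "\<one>\<^bsub>Z\<^esub> \<in> carrier Z"
    unfolding Z_def using group_two by simp_all
  \<comment> \<open>A state is a finite group with a marked element; \<open>lifts s s' \<pi>\<close> is one storey of the tower.\<close>
  define ok :: "nat \<Rightarrow> nat monoid \<times> nat \<Rightarrow> bool" where
    "ok n s \<longleftrightarrow> group (fst s) \<and> finite (carrier (fst s)) \<and> snd s \<in> carrier (fst s)
       \<and> (n = 0 \<longrightarrow> s = (Z, \<one>\<^bsub>Z\<^esub>))" for n s
  define lifts :: "nat monoid \<times> nat \<Rightarrow> nat monoid \<times> nat \<Rightarrow> (nat \<Rightarrow> nat) \<Rightarrow> bool" where
    "lifts s s' \<pi> \<longleftrightarrow> \<pi> \<in> hom (fst s') (fst s) \<and> \<pi> ` carrier (fst s') = carrier (fst s) \<and> \<pi> (snd s') = snd s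
       \<and> insoluble_outside (fst s') (snd s') {y. \<pi> y \<in> generate (fst s) {snd s}}" for s s' \<pi>
  have "\<exists>s. \<forall>n. ok n (s n) \<and> (\<exists>\<pi>. lifts (s n) (s (Suc n)) \<pi>)"
  proof (rule dependent_nat_choice)
    show "\<exists>s. ok 0 s" using Z by (auto simp: ok_def)
  next
    fix s n assume "ok n s"
    then have "group (fst s)" "finite (carrier (fst s))" "snd s \<in> carrier (fst s)"
      by (auto simp: ok_def)
    then obtain G' :: "nat monoid" and g' \<pi> where "group G'" "finite (carrier G')" "g' \<in> carrier G'"
      "\<pi> \<in> hom G' (fst s)" "\<pi> ` carrier G' = carrier (fst s)" "\<pi> g' = snd s"
      "insoluble_outside G' g' {y. \<pi> y \<in> generate (fst s) {snd s}}"
      by (rule insoluble_lift_nat)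
    then have "ok (Suc n) (G', g') \<and> lifts s (G', g') \<pi>"
      by (simp add: ok_def lifts_def)
    then show "\<exists>s'. ok (Suc n) s' \<and> (\<exists>\<pi>. lifts s s' \<pi>)" by blast
  qed
  then obtain s where s: "\<forall>n. ok n (s n) \<and> (\<exists>\<pi>. lifts (s n) (s (Suc n)) \<pi>)" ..
  then have "\<forall>n. \<exists>\<pi>. lifts (s n) (s (Suc n)) \<pi>" by simp
  then obtain \<pi> where \<pi>: "\<forall>n. lifts (s n) (s (Suc n)) (\<pi> n)" unfolding choice_iff ..
  interpret finite_group_tower "\<lambda>n. fst (s n)" "\<lambda>n. snd (s n)" \<pi>
  proof (rule finite_group_tower.intro)
    fix n
    show "group (fst (s n))" "finite (carrier (fst (s n)))" "snd (s n) \<in> carrier (fst (s n))"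
      using s[rule_format, of n] by (simp_all add: ok_def)
    show "\<pi> n \<in> hom (fst (s (Suc n))) (fst (s n))"
      "\<pi> n ` carrier (fst (s (Suc n))) = carrier (fst (s n))" "\<pi> n (snd (s (Suc n))) = snd (s n)"
      using \<pi>[rule_format, of n] by (simp_all add: lifts_def)
  qed
  have ins: "insoluble_outside (fst (s (Suc n))) (snd (s (Suc n)))
      {y. \<pi> n y \<in> generate (fst (s n)) {snd (s n)}}" for n
    using \<pi>[rule_format, of n] by (simp add: lifts_def)
  have s0: "s 0 = (Z, \<one>\<^bsub>Z\<^esub>)" using s[rule_format, of 0] by (simp add: ok_def)
  have "generate Z {\<one>\<^bsub>Z\<^esub>} = {\<one>\<^bsub>Z\<^esub>}" using Z(1) by (rule group.generate_one)
  then have "generate Z {\<one>\<^bsub>Z\<^esub>} \<noteq> carrier Z" by (auto simp: Z_def)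
  then have not_prosoluble: "\<not> prosoluble_group limit_group limit_topology"
    using not_prosoluble_limit[OF ins] s0 by simp
  show ?thesis
  proof (intro exI conjI bexI)
    show "profinite_group limit_group limit_topology" by (rule profinite_limit)
    show "\<not> prosoluble_group limit_group limit_topology" by (rule not_prosoluble)
    show "solubilizer limit_group limit_topology (\<lambda>n. snd (s n))
      = closed_subgroup_generated limit_group limit_topology {\<lambda>n. snd (s n)}"
      using ins by (rule solubilizer_g)
    show "(\<lambda>n. snd (s n)) \<in> carrier limit_group" by (rule g_in_limit)
  qed
qed

end
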